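(* For real $x$ with $-1 \le x < 1$, $$\sum_{n=1}^\infty \frac{\overline{H}_{n}}{n}x^{n}=-\log(2)\log(1-x)+Li_{2}\Big(\frac{1}{2}(1-x)\Big)-Li_{2}\Big(\frac{1}{2}\Big)-Li_{2}(-x),$$ and for $-1 < x < 1$ this also equals $$-\log(1-x)\log(1+x)+\log(2)\log(1+x)-Li_{2}\Big(\frac{1}{2}(1+x)\Big)+Li_{2}\Big(\frac{1}{2}\Big)-Li_{2}(-x).$$
   Context: $\overline{H}_n=\sum_{j=1}^n (-1)^{j-1}/j$. $\log$ is the natural logarithm. For real $|y|\le1$, $Li_2(y)=\sum_{n\ge1}y^n/n^2$ is the dilogarithm. *)

theory Defs
  imports Complex_Main
begin

definition alt_harm :: "nat \<Rightarrow> real" where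
  "alt_harm n = (\<Sum>j = 1..n. (-1) ^ (j - 1) / real j)"

text \<open>The series is indexed from \<open>0\<close>, so its \<open>n\<close>-th term is \<open>y ^ (n + 1) / (n + 1) ^ 2\<close>.
  It converges, and the definition is meaningful, exactly for \<open>\<bar>y\<bar> \<le> 1\<close>.\<close>

definition Li2 :: "real \<Rightarrow> real" where
  "Li2 y = (\<Sum>n. y ^ Suc n / (real (Suc n))\<^sup>2)"

end

theory Submission
  imports Defs "HOL-Analysis.Harmonic_Numbers" "HOL-Analysis.Uniform_Limit"
begin

text \<open>
  Replace the coefficient \<open>alt_harm n / n\<close> by \<open>(alt_harm n - ln 2) / n\<close>: the removed part sums to
  \<open>- ln 2 * ln (1 - x)\<close>, and by the Leibniz criterion what is left is bounded by \<open>1 / n\<^sup>2\<close>. The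
  centered series is therefore continuous on the closed interval \<open>[-1, 1]\<close>, just like
  \<open>Li2 ((1 - x) / 2) - Li2 (1/2) - Li2 (- x)\<close>; both vanish at \<open>0\<close> and have the same derivative
  inside, so they agree up to the endpoint \<open>-1\<close> without an appeal to Abel's theorem. The second
  form follows from Euler's reflection formula for the dilogarithm.
\<close>

section \<open>Power series with coefficients of order 1/n^2\<close>

lemma summable_inverse_Suc_squared: "summable (\<lambda>n. C / (real (Suc n))\<^sup>2)"
proof -
  have "summable (\<lambda>n. inverse (real (Suc n) ^ 2))"
    using inverse_power_summable[of 2, where ?'a = real] by (subst summable_Suc_iff) simp
  from summable_mult[OF this, of C] show ?thesis by (simp add: divide_inverse)
qed

lemma summable_quadratic_decay:
  fixes c :: "nat \<Rightarrow> real"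
  assumes c: "\<And>n. \<bar>c n\<bar> \<le> C / (real (Suc n))\<^sup>2" and x: "\<bar>x\<bar> \<le> 1"
  shows "summable (\<lambda>n. c n * x ^ Suc n)"
proof (rule summable_comparison_test'[OF summable_inverse_Suc_squared[of C]])
  fix n :: nat
  have "\<bar>c n\<bar> * \<bar>x\<bar> ^ Suc n \<le> \<bar>c n\<bar> * 1"
    using x by (intro mult_left_mono power_le_one) auto
  then show "norm (c n * x ^ Suc n) \<le> C / (real (Suc n))\<^sup>2"
    using c[of n] by (simp add: abs_mult power_abs)
qed

text \<open>The majorant C / (n+1)^2 does not depend on x, so convergence is uniform up to both
  endpoints and the polynomial partial sums pass their continuity on to the limit.\<close>

lemma continuous_on_quadratic_decay:
  fixes c :: "nat \<Rightarrow> real"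
  assumes c: "\<And>n. \<bar>c n\<bar> \<le> C / (real (Suc n))\<^sup>2"
  shows "continuous_on {-1..1} (\<lambda>x. \<Sum>n. c n * x ^ Suc n)"
proof -
  have "uniform_limit {-1..1} (\<lambda>N x. \<Sum>n<N. c n * x ^ Suc n)
          (\<lambda>x. \<Sum>n. c n * x ^ Suc n) sequentially"
  proof (rule Weierstrass_m_test[OF _ summable_inverse_Suc_squared[of C]])
    fix n :: nat and x :: real
    assume x: "x \<in> {-1..1}"
    have "\<bar>c n\<bar> * \<bar>x\<bar> ^ Suc n \<le> \<bar>c n\<bar> * 1"
      using x by (intro mult_left_mono power_le_one) auto
    then show "norm (c n * x ^ Suc n) \<le> C / (real (Suc n))\<^sup>2"
      using c[of n] by (simp add: abs_mult power_abs)
  qed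
  moreover have "continuous_on {-1..1} (\<lambda>x. \<Sum>n<N. c n * x ^ Suc n)" for N
    by (intro continuous_intros)
  ultimately show ?thesis
    by (intro uniform_limit_theorem[OF always_eventually]) auto
qed

text \<open>Termwise differentiation costs a factor n + 1, which leaves coefficients bounded by C; a
  geometric majorant then suffices, but only in the open interval.\<close>

lemma has_real_derivative_quadratic_decay:
  fixes c :: "nat \<Rightarrow> real"
  assumes c: "\<And>n. \<bar>c n\<bar> \<le> C / (real (Suc n))\<^sup>2" and x: "\<bar>x\<bar> < 1"
  shows "((\<lambda>x. \<Sum>n. c n * x ^ Suc n) has_real_derivative
           (\<Sum>n. c n * real (Suc n) * x ^ n)) (at x)"
proof (rule DERIV_power_series'[of 1])
  fix y :: real
  assume y: "y \<in> {-1<..<1}"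
  have C: "0 \<le> C" using c[of 0] by simp
  have "summable (\<lambda>n. C * \<bar>y\<bar> ^ n)"
    using y by (intro summable_mult summable_geometric) auto
  then show "summable (\<lambda>n. c n * real (Suc n) * y ^ n)"
  proof (rule summable_comparison_test')
    fix n :: nat
    have "\<bar>c n\<bar> * real (Suc n) \<le> C / (real (Suc n))\<^sup>2 * real (Suc n)"
      using c by (intro mult_right_mono) auto
    also have "\<dots> = C / real (Suc n)" by (simp add: power2_eq_square)
    also have "\<dots> \<le> C" using C by (simp add: field_simps)
    finally have "\<bar>c n\<bar> * real (Suc n) * \<bar>y\<bar> ^ n \<le> C * \<bar>y\<bar> ^ n"
      by (intro mult_right_mono) auto
    then show "norm (c n * real (Suc n) * y ^ n) \<le> C * \<bar>y\<bar> ^ n"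
      by (simp add: abs_mult power_abs)
  qed
qed (use x in auto)

section \<open>The logarithm series\<close>

text \<open>The value \<open>- ln (1 - y) / y\<close>, continued to \<open>y = 0\<close>.\<close>

definition log_quotient :: "real \<Rightarrow> real" where
  "log_quotient y = (\<Sum>n. y ^ n / real (Suc n))"

lemma summable_log_quotient:
  fixes y :: real
  assumes "\<bar>y\<bar> < 1"
  shows "summable (\<lambda>n. y ^ n / real (Suc n))"
proof (rule summable_comparison_test')
  show "summable (\<lambda>n. \<bar>y\<bar> ^ n)" using assms by (intro summable_geometric) auto
  show "norm (y ^ n / real (Suc n)) \<le> \<bar>y\<bar> ^ n" for n
    by (simp add: power_abs divide_le_eq mult_le_cancel_left1)
qed

text \<open>\<open>ln_series\<close> covers the open interval; the endpoint -1 is the alternating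
  harmonic series with its sign reversed.\<close>

lemma sums_minus_ln_one_minus:
  fixes x :: real
  assumes "-1 \<le> x" "x < 1"
  shows "(\<lambda>n. x ^ Suc n / real (Suc n)) sums (- ln (1 - x))"
proof (cases "x = -1")
  case True
  then show ?thesis
    using sums_minus[OF alternating_harmonic_series_sums] by simp
next
  case False
  have "(-1) ^ n * (1 / real (n + 1)) * (1 - x - 1) ^ Suc n = - (x ^ Suc n / real (Suc n))" for n
    by (simp flip: power_mult_distrib)
  then have "ln (1 - x) = (\<Sum>n. - (x ^ Suc n / real (Suc n)))"
    using ln_series[of "1 - x"] assms False by (simp only:)
  moreover have sm: "summable (\<lambda>n. x ^ Suc n / real (Suc n))"
    using summable_mult[OF summable_log_quotient[of x], of x] assms False by simp
  ultimately show ?thesis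
    using suminf_minus[OF sm] by (simp add: sums_iff)
qed

text \<open>The product form avoids a division and so includes y = 0.\<close>

lemma mult_log_quotient:
  assumes "\<bar>y\<bar> < 1"
  shows "y * log_quotient y = - ln (1 - y)"
proof -
  have "(\<lambda>n. y * (y ^ n / real (Suc n))) sums (y * log_quotient y)"
    unfolding log_quotient_def by (intro sums_mult summable_sums summable_log_quotient assms)
  moreover have "(\<lambda>n. y * (y ^ n / real (Suc n))) sums (- ln (1 - y))"
    using sums_minus_ln_one_minus[of y] assms by simp
  ultimately show ?thesis by (rule sums_unique2)
qed

section \<open>The dilogarithm and its reflection formula\<close>

lemma Li2_altdef: "Li2 = (\<lambda>y. \<Sum>n. 1 / (real (Suc n))\<^sup>2 * y ^ Suc n)"
  by (simp add: Li2_def fun_eq_iff)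

lemma continuous_on_Li2: "continuous_on {-1..1} Li2"
  unfolding Li2_altdef by (rule continuous_on_quadratic_decay[of _ 1]) simp

lemma has_real_derivative_Li2:
  assumes "\<bar>y\<bar> < 1"
  shows "(Li2 has_real_derivative log_quotient y) (at y)"
proof -
  have "(Li2 has_real_derivative (\<Sum>n. 1 / (real (Suc n))\<^sup>2 * real (Suc n) * y ^ n)) (at y)"
    unfolding Li2_altdef
    by (rule has_real_derivative_quadratic_decay[of _ 1]) (use assms in simp_all)
  also have "(\<lambda>n. 1 / (real (Suc n))\<^sup>2 * real (Suc n) * y ^ n) = (\<lambda>n. y ^ n / real (Suc n))"
    by (simp add: fun_eq_iff power2_eq_square)
  finally show ?thesis by (simp add: log_quotient_def)
qed

lemma has_real_derivative_Li2_compose: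
  assumes "(g has_real_derivative g') (at x)" "\<bar>g x\<bar> < 1"
  shows "((\<lambda>x. Li2 (g x)) has_real_derivative log_quotient (g x) * g') (at x)"
  using DERIV_chain2[of Li2 "log_quotient (g x)" g x g' UNIV] has_real_derivative_Li2 assms
  by blast

text \<open>The derivative of the left side cancels term by term on (0,1). Evaluating the constant
  at the midpoint 1/2 avoids limits at 0 and 1 and the closed value pi^2/6.\<close>

lemma Li2_reflection_half:
  assumes "0 < y" "y < 1"
  shows "Li2 y + Li2 (1 - y) + ln y * ln (1 - y) = 2 * Li2 (1/2) + (ln 2)\<^sup>2"
proof -
  define R where "R = (\<lambda>y. Li2 y + Li2 (1 - y) + ln y * ln (1 - y))"
  have "R y = R (1/2)"
  proof (rule DERIV_isconst3[where f = R and a = 0 and b = 1])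
    fix t :: real
    assume t: "t \<in> {0<..<1}"
    have "(Li2 has_real_derivative log_quotient t) (at t)"
      using t by (intro has_real_derivative_Li2) auto
    moreover have "((\<lambda>t. Li2 (1 - t)) has_real_derivative log_quotient (1 - t) * (-1)) (at t)"
      using t by (intro has_real_derivative_Li2_compose) (auto intro!: derivative_eq_intros)
    moreover have "((\<lambda>t. ln t * ln (1 - t)) has_real_derivative
        ln (1 - t) / t - ln t / (1 - t)) (at t)"
      using t by (auto intro!: derivative_eq_intros simp: field_simps)
    ultimately have "(R has_real_derivative log_quotient t + log_quotient (1 - t) * (-1)
            + (ln (1 - t) / t - ln t / (1 - t))) (at t)"
      unfolding R_def by (intro DERIV_add)
    moreover have "log_quotient t = - ln (1 - t) / t"
      "log_quotient (1 - t) = - ln t / (1 - t)"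
      using mult_log_quotient[of t] mult_log_quotient[of "1 - t"] t
      by (auto simp: field_simps)
    ultimately show "(R has_real_derivative 0) (at t)" by simp
  qed (use assms in auto)
  then show ?thesis by (simp add: R_def ln_div power2_eq_square)
qed

section \<open>Alternating harmonic numbers: rate of convergence and generating function\<close>

lemma alt_harm_eq_lessThan: "alt_harm n = (\<Sum>j<n. (-1) ^ j / real (Suc j))"
  unfolding alt_harm_def
  by (rule sum.reindex_bij_witness[of _ Suc "\<lambda>j. j - 1"]) auto

text \<open>Even partial sums lie below ln 2 and odd ones above, so ln 2 lies between
  \<open>alt_harm n\<close> and \<open>alt_harm (Suc n)\<close>, whose distance is 1/(n+1).\<close>

lemma abs_alt_harm_minus_ln2_le: "\<bar>alt_harm (Suc n) - ln 2\<bar> \<le> 1 / real (Suc n)"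
proof -
  let ?a = "\<lambda>n. 1 / real (Suc n)"
  have a: "?a \<longlonglongrightarrow> 0" "0 \<le> ?a n" "?a (Suc n) \<le> ?a n" for n
    using LIMSEQ_inverse_real_of_nat by (auto simp: field_simps)
  have ln2: "(\<Sum>i. (-1) ^ i * ?a i) = ln 2"
    using alternating_harmonic_series_sums by (simp add: sums_iff)
  have eq: "alt_harm m = (\<Sum>i<m. (-1) ^ i * ?a i)" for m
    by (simp add: alt_harm_eq_lessThan)
  have lower: "alt_harm (2 * k) \<le> ln 2" for k
    using summable_Leibniz'(2)[of ?a k] a unfolding eq ln2 by simp
  have upper: "ln 2 \<le> alt_harm (2 * k + 1)" for k
    using summable_Leibniz'(4)[of ?a k] a unfolding eq ln2 by simp
  have step: "alt_harm (Suc n) = alt_harm n + (-1) ^ n / real (Suc n)"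
    by (simp add: alt_harm_eq_lessThan)
  show ?thesis
  proof (cases "even n")
    case True
    then obtain k where "n = 2 * k" by blast
    then show ?thesis using step lower[of k] upper[of k] by (simp add: abs_if)
  next
    case False
    then obtain k where "n = 2 * k + 1" by (blast elim: oddE)
    then show ?thesis using step lower[of "Suc k"] upper[of k] by (simp add: abs_if)
  qed
qed

text \<open>Multiplying a power series by the geometric series replaces its coefficients by their
  partial sums; here the Cauchy product is taken with the series of
  \<open>log_quotient (- x)\<close>.\<close>

lemma alt_harm_generating_function:
  fixes x :: real
  assumes x: "\<bar>x\<bar> < 1"
  shows "(\<lambda>n. alt_harm (Suc n) * x ^ n) sums (log_quotient (- x) / (1 - x))"
proof -
  let ?a = "\<lambda>n. (- x) ^ n / real (Suc n)"
  have "(\<lambda>k. \<Sum>i\<le>k. ?a i * x ^ (k - i)) sums ((\<Sum>k. ?a k) * (\<Sum>k. x ^ k))"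
  proof (rule Cauchy_product_sums)
    show "summable (\<lambda>k. norm (?a k))"
    proof (rule summable_comparison_test')
      show "summable (\<lambda>n. \<bar>x\<bar> ^ n)" using x by (intro summable_geometric) auto
      show "norm (norm (?a n)) \<le> \<bar>x\<bar> ^ n" for n
        by (simp add: power_abs divide_le_eq mult_le_cancel_left1)
    qed
    show "summable (\<lambda>k. norm (x ^ k))"
      using x by (simp add: power_abs summable_geometric)
  qed
  also have "(\<lambda>k. \<Sum>i\<le>k. ?a i * x ^ (k - i)) = (\<lambda>n. alt_harm (Suc n) * x ^ n)"
  proof
    fix n
    have "?a i * x ^ (n - i) = (-1) ^ i / real (Suc i) * x ^ n" if "i \<le> n" for i
    proof -
      have "(- x) ^ i * x ^ (n - i) = (-1) ^ i * (x ^ i * x ^ (n - i))"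
        by (simp add: power_minus[of x])
      also have "x ^ i * x ^ (n - i) = x ^ n"
        using that by (simp flip: power_add)
      finally show ?thesis by simp
    qed
    then show "(\<Sum>i\<le>n. ?a i * x ^ (n - i)) = alt_harm (Suc n) * x ^ n"
      by (simp add: alt_harm_eq_lessThan lessThan_Suc_atMost sum_distrib_right)
  qed
  also have "(\<Sum>k. x ^ k) = 1 / (1 - x)" using x by (simp add: suminf_geometric)
  finally show ?thesis by (simp add: log_quotient_def)
qed

section \<open>The centered series and its closed form\<close>

definition centered_series :: "real \<Rightarrow> real" where
  "centered_series x = (\<Sum>n. (alt_harm (Suc n) - ln 2) / real (Suc n) * x ^ Suc n)"

lemma centered_coeff_bound:
  "\<bar>(alt_harm (Suc n) - ln 2) / real (Suc n)\<bar> \<le> 1 / (real (Suc n))\<^sup>2"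
proof -
  have "\<bar>alt_harm (Suc n) - ln 2\<bar> / real (Suc n) \<le> 1 / real (Suc n) / real (Suc n)"
    by (intro divide_right_mono abs_alt_harm_minus_ln2_le) simp
  then show ?thesis by (simp add: power2_eq_square)
qed

text \<open>Differentiation cancels the denominator \<open>Suc n\<close>, leaving the generating
  function of \<open>alt_harm\<close> minus ln 2 times the geometric series.\<close>

lemma has_real_derivative_centered_series:
  assumes x: "\<bar>x\<bar> < 1"
  shows "(centered_series has_real_derivative (log_quotient (- x) - ln 2) / (1 - x)) (at x)"
proof -
  have "(\<lambda>n. alt_harm (Suc n) * x ^ n - ln 2 * x ^ n) sums
          (log_quotient (- x) / (1 - x) - ln 2 * (1 / (1 - x)))"
    using x by (intro sums_diff alt_harm_generating_function sums_mult geometric_sums) auto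
  also have "(\<lambda>n. alt_harm (Suc n) * x ^ n - ln 2 * x ^ n) =
      (\<lambda>n. (alt_harm (Suc n) - ln 2) / real (Suc n) * real (Suc n) * x ^ n)"
    by (simp add: fun_eq_iff left_diff_distrib[symmetric] del: of_nat_Suc)
  finally have "(\<Sum>n. (alt_harm (Suc n) - ln 2) / real (Suc n) * real (Suc n) * x ^ n) =
      (log_quotient (- x) - ln 2) / (1 - x)"
    by (simp add: sums_iff diff_divide_distrib)
  then show ?thesis
    using has_real_derivative_quadratic_decay[OF centered_coeff_bound x]
    by (simp add: centered_series_def[abs_def])
qed

lemma centered_series_eq:
  assumes x: "\<bar>x\<bar> \<le> 1"
  shows "centered_series x = Li2 ((1 - x) / 2) - Li2 (1/2) - Li2 (- x)"
proof -
  define D where "D = (\<lambda>x. centered_series x - Li2 ((1 - x) / 2) + Li2 (- x))"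
  have cont: "continuous_on {-1..1} D"
    unfolding D_def centered_series_def
    by (intro continuous_intros continuous_on_quadratic_decay[OF centered_coeff_bound]
          continuous_on_compose2[OF continuous_on_Li2]) auto
  have deriv: "(D has_real_derivative 0) (at t)" if t: "-1 < t" "t < 1" for t
  proof -
    have "((\<lambda>t. Li2 ((1 - t) / 2)) has_real_derivative log_quotient ((1 - t) / 2) * (-1/2)) (at t)"
      using t by (intro has_real_derivative_Li2_compose) (auto intro!: derivative_eq_intros)
    moreover have "((\<lambda>t. Li2 (- t)) has_real_derivative log_quotient (- t) * (-1)) (at t)"
      using t by (intro has_real_derivative_Li2_compose) (auto intro!: derivative_eq_intros)
    moreover have "(centered_series has_real_derivative (log_quotient (- t) - ln 2) / (1 - t)) (at t)"
      using t by (intro has_real_derivative_centered_series) auto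
    ultimately have D: "(D has_real_derivative (log_quotient (- t) - ln 2) / (1 - t)
            - log_quotient ((1 - t) / 2) * (-1/2) + log_quotient (- t) * (-1)) (at t)"
      unfolding D_def by (intro DERIV_add DERIV_diff)
    \<comment> \<open>Multiplied by 1 - t, the derivative of \<open>D\<close> becomes the sum of
      these two products minus ln 2. No division by t occurs, so t = 0 needs no separate
      case.\<close>
    have "t * log_quotient (- t) = ln (1 + t)"
      using mult_log_quotient[of "- t"] t by simp
    moreover have "(1 - t) * log_quotient ((1 - t) / 2) / 2 = ln 2 - ln (1 + t)"
    proof -
      have "1 - (1 - t) / 2 = (1 + t) / 2" by (simp add: field_simps)
      then show ?thesis
        using mult_log_quotient[of "(1 - t) / 2"] t by (simp only:) (simp add: ln_div)
    qed
    ultimately have "(log_quotient (- t) - ln 2) / (1 - t)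
        - log_quotient ((1 - t) / 2) * (-1/2) + log_quotient (- t) * (-1) = 0"
      using t by (simp add: field_simps)
    with D show ?thesis by simp
  qed
  \<comment> \<open>\<open>DERIV_isconst2\<close> compares with the left endpoint, hence the detour
    through -1. The value sought is \<open>D 0\<close>, where the two series in x vanish and only -
    Li2 (1/2) remains.\<close>
  have "D x = D (-1)" "D 0 = D (-1)"
    using x by (auto intro!: DERIV_isconst2[OF _ cont deriv])
  then have "D x = D 0" by simp
  then show ?thesis
    by (simp add: D_def centered_series_def Li2_def)
qed

theorem theorem5:
  fixes x :: real
  assumes "-1 \<le> x" and "x < 1"
  shows "(\<lambda>n. alt_harm (Suc n) / real (Suc n) * x ^ Suc n) sums
        (- ln 2 * ln (1 - x) + Li2 (1/2 * (1 - x)) - Li2 (1/2) - Li2 (- x))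
    \<and> (-1 < x \<longrightarrow>
      (\<lambda>n. alt_harm (Suc n) / real (Suc n) * x ^ Suc n) sums
        (- ln (1 - x) * ln (1 + x) + ln 2 * ln (1 + x)
          - Li2 (1/2 * (1 + x)) + Li2 (1/2) - Li2 (- x)))"
    (is "?f sums ?A \<and> (_ \<longrightarrow> ?f sums ?B)")
proof -
  have "(\<lambda>n. (alt_harm (Suc n) - ln 2) / real (Suc n) * x ^ Suc n) sums centered_series x"
    unfolding centered_series_def using assms
    by (intro summable_sums summable_quadratic_decay[OF centered_coeff_bound]) auto
  \<comment> \<open>Undo the centering: add back ln 2 times the logarithm series, which still
    converges at x = -1.\<close>
  from sums_add[OF this sums_mult[OF sums_minus_ln_one_minus[OF assms], of "ln 2"]]
  have "?f sums (centered_series x + ln 2 * (- ln (1 - x)))"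
    by (simp add: algebra_simps diff_divide_distrib del: of_nat_Suc power_Suc)
  then have A: "?f sums ?A"
    using centered_series_eq[of x] assms by (simp add: algebra_simps)
  \<comment> \<open>Reflection at y = (1 - x) / 2, where y < 1 requires x > -1. When the product of
    logarithms is expanded, the squares of ln 2 cancel, and its term in ln 2 * ln (1 - x) cancels
    the one in \<open>?A\<close>.\<close>
  have "?A = ?B" if "-1 < x"
  proof -
    have "1 - (1 - x) / 2 = (1 + x) / 2" by (simp add: field_simps)
    then have "Li2 ((1 - x) / 2) + Li2 ((1 + x) / 2)
        + (ln (1 - x) - ln 2) * (ln (1 + x) - ln 2) = 2 * Li2 (1/2) + (ln 2)\<^sup>2"
      using Li2_reflection_half[of "(1 - x) / 2"] that assms by (simp only:) (simp add: ln_div)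
    then show ?thesis by (simp add: algebra_simps power2_eq_square)
  qed
  with A show ?thesis by metis
qed

end
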